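(* There exist polynomials $b_{n,k}(q)\in\mathbb{N}[q]$ (for integers $n\ge 1$ and $k\in\mathbb{Z}$) such that for every positive integer $n$ the $q$-Eulerian polynomial of type $B$, $B_n(t,q)=\sum_{k=0}^n B_{n,k}(q)t^k$, can be written as $$B_n(t,q)=\sum_{k=0}^{\lfloor n/2\rfloor} b_{n,k}(q)\,t^{k}\,(-tq^{2k+1};q^2)_{n-2k}.$$ Moreover, these polynomials satisfy the recurrence relation $$b_{n,k}(q)=[2k+1]_q\,b_{n-1,k}(q)+(1+q)(1+q^{2k-1})\,q^{2k-1}\,[n+1-2k]_{q^2}\,b_{n-1,k-1}(q)$$ for $n\ge 2$ and $0\le k\le\lfloor n/2\rfloor$, with $b_{1,0}(q)=1$ and $b_{n,k}(q)=0$ for $k<0$ or $k>\lfloor n/2\rfloor$.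
   Context: Notation: $q$ and $t$ are indeterminates; $\mathbb{N}=\{0,1,2,\dots\}$, so $\mathbb{N}[q]$ is the set of polynomials in $q$ with nonnegative integer coefficients; $[m]_q=1+q+\cdots+q^{m-1}$ (with $[0]_q=0$), and $[m]_{q^2}$ is the same expression with $q$ replaced by $q^2$; $(x;q)_m=(1-x)(1-xq)\cdots(1-xq^{m-1})$ with $(x;q)_0=1$, and $(x;q^2)_m$ is obtained by replacing $q$ by $q^2$. The Chow--Gessel $q$-Eulerian polynomials of type $B$, $B_n(t,q)=\sum_{k=0}^n B_{n,k}(q)t^k$ (polynomials in $t$ with coefficients in $\mathbb{Z}[q]$), are defined by $$\sum_{k\ge 0}[2k+1]_q^n\,t^k=\frac{B_n(t,q)}{(t;q^2)_{n+1}}.$$ *)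

theory Defs
  imports "HOL-Computational_Algebra.Computational_Algebra"
begin

definition qint :: "'a::comm_semiring_1 \<Rightarrow> nat \<Rightarrow> 'a" where
  "qint x m = (\<Sum>i<m. x ^ i)"

definition qpoch :: "'a::comm_ring_1 \<Rightarrow> 'a \<Rightarrow> nat \<Rightarrow> 'a" where
  "qpoch x p m = (\<Prod>i<m. 1 - x * p ^ i)"

text \<open>
  Polynomials in \<open>t\<close> with coefficients in \<open>\<int>[q]\<close> have type \<open>int poly poly\<close>: the outer variable
  is \<open>t\<close>, the inner one is \<open>q\<close>, and a coefficient \<open>c \<in> \<int>[q]\<close> is embedded as \<open>[:c:]\<close>.
\<close>

abbreviation qvar :: "int poly" where
  "qvar \<equiv> [:0, 1:]"

abbreviation tvar :: "int poly poly" where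
  "tvar \<equiv> [:0, 1:]"

text \<open>
  The generating function identity, an identity of formal power series in \<open>t\<close> over \<open>\<int>[q]\<close>, is
  stated with its denominator \<open>(t;q\<^sup>2)\<^bsub>n+1\<^esub>\<close> cleared; this is harmless since the denominator has
  constant term 1. The two lemmas below show that such a polynomial exists, is unique, and has
  degree at most \<open>n\<close> in \<open>t\<close>.
\<close>

definition eulerian_B :: "nat \<Rightarrow> int poly poly" where
  "eulerian_B n = (THE B. Abs_fps (\<lambda>k. qint qvar (2 * k + 1) ^ n) *
      fps_of_poly (qpoch tvar [:qvar ^ 2:] (n + 1)) = fps_of_poly B)"

lemma eulerian_B_exists:
  "\<exists>B. degree B \<le> n \<and> Abs_fps (\<lambda>k. qint qvar (2 * k + 1) ^ n) *
      fps_of_poly (qpoch tvar [:qvar ^ 2:] (n + 1)) = fps_of_poly B"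
proof -
  let ?q = qvar
  define P where "P = (1 - ?q) ^ n"
  define F where "F = Abs_fps (\<lambda>k. qint ?q (2 * k + 1) ^ n)"
  define D where "D = qpoch tvar [:?q ^ 2:] (n + 1)"
  define c where "c j = of_nat (n choose j) * (-1) ^ j * ?q ^ j" for j
  define G where "G j = Abs_fps (\<lambda>k. ?q ^ (2 * j * k))" for j
  define L where "L j = 1 - tvar * [:?q ^ 2:] ^ j" for j
  define D' where "D' j = (\<Prod>i\<in>{..<n+1}-{j}. L i)" for j
  define R where "R = (\<Sum>j\<le>n. smult (c j) (D' j))"
  have P0: "P \<noteq> 0"
    by (simp add: P_def one_pCons)
  have qint1: "(1 - ?q) * qint ?q m = 1 - ?q ^ m" for m
    unfolding qint_def by (rule one_diff_power_eq[symmetric])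
  have "P * F $ k = (\<Sum>j\<le>n. c j * G j $ k)" for k
  proof -
    have "P * F $ k = (1 - ?q ^ (2 * k + 1)) ^ n"
      unfolding P_def F_def by (simp only: fps_nth_Abs_fps power_mult_distrib[symmetric] qint1)
    also have "\<dots> = (- (?q ^ (2 * k + 1)) + 1) ^ n"
      by (simp only: uminus_add_conv_diff)
    also have "\<dots> = (\<Sum>j\<le>n. of_nat (n choose j) * (- (?q ^ (2 * k + 1))) ^ j * 1 ^ (n - j))"
      by (rule binomial_ring)
    also have "\<dots> = (\<Sum>j\<le>n. c j * G j $ k)"
    proof (rule sum.cong[OF refl])
      fix j
      have "(- (?q ^ (2 * k + 1))) ^ j = (-1) ^ j * ?q ^ ((2 * k + 1) * j)"
        by (subst power_minus) (simp only: power_mult)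
      also have "(2 * k + 1) * j = j + 2 * j * k"
        by (simp add: algebra_simps)
      finally show "of_nat (n choose j) * (- (?q ^ (2 * k + 1))) ^ j * 1 ^ (n - j) = c j * G j $ k"
        unfolding c_def G_def by (simp only: fps_nth_Abs_fps power_add power_one mult.assoc mult_1_right)
    qed
    finally show ?thesis .
  qed
  then have PF: "fps_const P * F = (\<Sum>j\<le>n. fps_const (c j) * G j)"
    by (intro fps_ext) (simp add: fps_sum_nth)
  have L_eq: "L j = [:1, - (?q ^ (2 * j)):]" for j
    by (simp add: L_def one_pCons poly_const_pow flip: power_mult)
  have GL: "G j * fps_of_poly (L j) = 1" for j
  proof (rule fps_ext)
    fix k
    have "fps_of_poly (L j) = 1 - fps_X * fps_const (?q ^ (2 * j))"
      by (simp add: L_eq fps_of_poly_pCons flip: fps_const_neg)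
    then have *: "G j * fps_of_poly (L j) = G j - fps_const (?q ^ (2 * j)) * (fps_X * G j)"
      by (simp only: right_diff_distrib mult_1_right mult_1_left ac_simps)
    show "(G j * fps_of_poly (L j)) $ k = 1 $ k"
      unfolding * by (cases k) (simp_all add: G_def power_add[symmetric] del: mult_pCons_left)
  qed
  have D_eq: "D = L j * D' j" if "j \<le> n" for j
    unfolding D_def qpoch_def D'_def L_def using that by (intro prod.remove) auto
  have "fps_const P * F * fps_of_poly D = fps_of_poly R"
  proof -
    have "fps_const (c j) * G j * fps_of_poly D = fps_of_poly (smult (c j) (D' j))" if "j \<le> n" for j
    proof -
      have "fps_const (c j) * G j * fps_of_poly D =
            fps_const (c j) * (G j * fps_of_poly (L j)) * fps_of_poly (D' j)"
        unfolding D_eq[OF that] by (simp only: fps_of_poly_mult mult.assoc)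
      then show ?thesis
        by (simp add: GL fps_of_poly_smult)
    qed
    then show ?thesis
      by (simp add: PF R_def sum_distrib_right fps_of_poly_sum)
  qed
  then have coeffs: "P * (F * fps_of_poly D) $ k = coeff R k" for k
    by (metis fps_mult_left_const_nth fps_of_poly_nth mult.assoc)
  have "degree (D' j) \<le> n" if "j \<le> n" for j
  proof -
    have "degree (D' j) \<le> sum (degree \<circ> L) ({..<n+1}-{j})"
      unfolding D'_def by (rule degree_prod_sum_le) simp
    also have "\<dots> \<le> (\<Sum>i\<in>{..<n+1}-{j}. 1)"
      by (intro sum_mono) (simp add: L_eq)
    also have "\<dots> = n"
      using that by simp
    finally show ?thesis .
  qed
  then have "degree R \<le> n"
    unfolding R_def by (intro degree_sum_le) (auto intro: order.trans[OF degree_smult_le])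
  with coeffs P0 have zero: "(F * fps_of_poly D) $ k = 0" if "k > n" for k
    using that by (metis coeff_eq_0 le_less_trans mult_eq_0_iff)
  define B where "B = (\<Sum>k\<le>n. monom ((F * fps_of_poly D) $ k) k)"
  have B_coeff: "coeff B k = (F * fps_of_poly D) $ k" for k
    using zero[of k] by (auto simp: B_def coeff_sum not_le)
  have "degree B \<le> n"
    by (rule degree_le) (simp add: B_coeff zero)
  moreover have "F * fps_of_poly D = fps_of_poly B"
    by (rule fps_ext) (simp add: B_coeff)
  ultimately show ?thesis
    unfolding F_def D_def by blast
qed

lemma eulerian_B:
  shows eulerian_B_eq: "Abs_fps (\<lambda>k. qint qvar (2 * k + 1) ^ n) *
      fps_of_poly (qpoch tvar [:qvar ^ 2:] (n + 1)) = fps_of_poly (eulerian_B n)"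
    and degree_eulerian_B: "degree (eulerian_B n) \<le> n"
proof -
  obtain B where B: "degree B \<le> n" "Abs_fps (\<lambda>k. qint qvar (2 * k + 1) ^ n) *
      fps_of_poly (qpoch tvar [:qvar ^ 2:] (n + 1)) = fps_of_poly B"
    using eulerian_B_exists by blast
  then have "eulerian_B n = B"
    unfolding eulerian_B_def by (intro the_equality) (simp_all add: fps_of_poly_eq_iff)
  with B show "Abs_fps (\<lambda>k. qint qvar (2 * k + 1) ^ n) *
      fps_of_poly (qpoch tvar [:qvar ^ 2:] (n + 1)) = fps_of_poly (eulerian_B n)"
    and "degree (eulerian_B n) \<le> n"
    by simp_all
qed

end

theory Submission
  imports Defs
begin

text \<open>
  Since \<open>(1 - q) [2k+1]\<^sub>q = 1 - q \<cdot> q\<^bsup>2k\<^esup>\<close>, raising the exponent \<open>n\<close> by one turns the generating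
  function \<open>F(t) = \<Sum>\<^sub>k [2k+1]\<^sub>q\<^bsup>n\<^esup> t\<^bsup>k\<^esup>\<close> into \<open>(F(t) - q F(q\<^sup>2t)) / (1 - q)\<close>. Clearing denominators
  gives the \<open>q\<close>-difference recurrence (lemma \<open>eulerian_B_Suc\<close>)
  \<open>(1 - q) B\<^bsub>n+1\<^esub>(t) = (1 - t q\<^bsup>2n+2\<^esup>) B\<^sub>n(t) - q (1 - t) B\<^sub>n(q\<^sup>2t)\<close>.

  The operator on the right-hand side maps the basis element
  \<open>\<gamma>\<^bsub>n,k\<^esub> = t\<^bsup>k\<^esup> (-tq\<^bsup>2k+1\<^esup>;q\<^sup>2)\<^bsub>n-2k\<^esub>\<close> to a combination of \<open>\<gamma>\<^bsub>n+1,k\<^esub>\<close> and \<open>\<gamma>\<^bsub>n+1,k+1\<^esub>\<close> only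
  (lemma \<open>gamma_basis_step\<close>), and its two coefficients, divided by \<open>1 - q\<close>, are those of the
  recurrence for \<open>b\<^bsub>n,k\<^esub>\<close>. Defining \<open>b\<^bsub>n,k\<^esub>\<close> by that recurrence therefore yields the expansion by
  induction on \<open>n\<close>, starting from \<open>B\<^sub>0 = 1\<close>; nonnegativity is visible from the recurrence.
\<close>

section \<open>\<open>q\<close>-integers and \<open>q\<close>-shifted factorials\<close>

lemma qpoch_0 [simp]: "qpoch x p 0 = 1"
  by (simp add: qpoch_def)

lemma qpoch_Suc: "qpoch x p (Suc m) = qpoch x p m * (1 - x * p ^ m)"
  by (simp add: qpoch_def)

lemma qpoch_Suc_shift: "qpoch x p (Suc m) = (1 - x) * qpoch (x * p) p m"
  unfolding qpoch_def by (subst prod.lessThan_Suc_shift) (simp add: mult.assoc)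

lemma one_minus_mult_qint: "(1 - x) * qint x m = 1 - x ^ m"
  for x :: "'a::comm_ring_1"
  unfolding qint_def by (rule one_diff_power_eq[symmetric])

lemma const_poly_add: "[:a + b:] = [:a:] + [:b:]"
  by simp

lemma const_poly_mult: "[:a * b:] = [:a:] * [:b:]"
  for a :: "'a::comm_semiring_0"
  by (simp add: mult.commute)

lemma const_poly_qint: "[:qint x m:] = qint [:x:] m"
proof (induction m)
  case (Suc m)
  then show ?case
    unfolding qint_def sum.lessThan_Suc const_poly_add poly_const_pow by simp
qed (simp add: qint_def)

lemma pcompose_power: "pcompose (p ^ m) r = pcompose p r ^ m"
  for p r :: "'a::comm_semiring_1 poly"
  by (induction m) (simp_all add: pcompose_mult pcompose_1)

lemma pcompose_qpoch: "pcompose (qpoch x p m) r = qpoch (pcompose x r) (pcompose p r) m"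
  by (induction m) (simp_all add: qpoch_Suc pcompose_mult pcompose_diff pcompose_power pcompose_1)

section \<open>The \<open>\<gamma>\<close>-basis under the \<open>q\<close>-difference operator\<close>

text \<open>
  The basis elements \<open>t\<^bsup>k\<^esup> (-tq\<^bsup>2k+1\<^esup>;q\<^sup>2)\<^bsub>n-2k\<^esub>\<close>, for elements \<open>q\<close> and \<open>t\<close> of any commutative
  ring. They are meaningful for \<open>2k \<le> n\<close> only; for larger \<open>k\<close> the truncated subtraction gives \<open>t\<^bsup>k\<^esup>\<close>,
  which only ever occurs with coefficient \<open>0\<close>.
\<close>
definition gamma_basis :: "'a::comm_ring_1 \<Rightarrow> 'a \<Rightarrow> nat \<Rightarrow> nat \<Rightarrow> 'a" where
  "gamma_basis q t n k = t ^ k * qpoch (- t * q ^ (2 * k + 1)) (q ^ 2) (n - 2 * k)"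

text \<open>
  The coefficient with which \<open>b\<^bsub>n,k\<^esub>\<close> enters the recurrence for \<open>b\<^bsub>n+1,k+1\<^esub>\<close>. It vanishes
  for \<open>2k \<ge> n\<close>.
\<close>
definition gamma_weight :: "'a::comm_ring_1 \<Rightarrow> nat \<Rightarrow> nat \<Rightarrow> 'a" where
  "gamma_weight q n k =
     (1 + q) * (1 + q ^ (2 * k + 1)) * q ^ (2 * k + 1) * qint (q ^ 2) (n - 2 * k)"

lemma gamma_weight_eq_0: "n \<le> 2 * k \<Longrightarrow> gamma_weight q n k = 0"
  by (simp add: gamma_weight_def qint_def)

lemma const_poly_gamma_weight: "[:gamma_weight q n k:] = gamma_weight [:q:] n k"
  unfolding gamma_weight_def const_poly_mult const_poly_add const_poly_qint
    poly_const_pow[symmetric] one_pCons ..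

lemma gamma_basis_step:
  fixes q t :: "'a::comm_ring_1"
  assumes "2 * k \<le> n"
  shows "(1 - t * q ^ (2 * n + 2)) * gamma_basis q t n k - q * (1 - t) * gamma_basis q (t * q ^ 2) n k
    = (1 - q) * (qint q (2 * k + 1) * gamma_basis q t (Suc n) k
        + gamma_weight q n k * gamma_basis q t (Suc n) (Suc k))"
proof -
  define m where "m = n - 2 * k"
  define a where "a = q ^ (2 * k + 1)"
  define u where "u = q ^ (2 * m)"
  have n: "n = 2 * k + m"
    using assms by (simp add: m_def)
  have top: "q ^ (2 * n + 2) = a ^ 2 * u"
    by (simp add: a_def u_def n algebra_simps flip: power_add power_mult)
  have shift: "q * (t * q ^ 2) ^ k = a * t ^ k"
    by (simp add: a_def power_mult_distrib algebra_simps flip: power_mult)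
  have w: "(1 - q) * gamma_weight q n k = a * (1 + a) * (1 - u)"
  proof -
    have "(1 - q) * gamma_weight q n k = a * (1 + a) * ((1 - q ^ 2) * qint (q ^ 2) m)"
      unfolding gamma_weight_def m_def[symmetric] a_def[symmetric]
      by (simp add: algebra_simps power2_eq_square)
    then show ?thesis
      by (simp add: one_minus_mult_qint u_def flip: power_mult)
  qed
  have low: "(1 - q) * qint q (2 * k + 1) = 1 - a"
    unfolding a_def by (rule one_minus_mult_qint)
  have basis: "gamma_basis q t n k = t ^ k * qpoch (- t * a) (q ^ 2) m"
    and basis_shift: "q * gamma_basis q (t * q ^ 2) n k = a * t ^ k * qpoch (- t * a * q ^ 2) (q ^ 2) m"
    and basis_Suc: "gamma_basis q t (Suc n) k = t ^ k * qpoch (- t * a) (q ^ 2) (Suc m)"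
    using assms unfolding shift[symmetric]
    by (simp_all add: gamma_basis_def a_def m_def Suc_diff_le mult_ac)
  have lhs: "(1 - t * q ^ (2 * n + 2)) * gamma_basis q t n k - q * (1 - t) * gamma_basis q (t * q ^ 2) n k
      = (1 - t * q ^ (2 * n + 2)) * gamma_basis q t n k - (1 - t) * (q * gamma_basis q (t * q ^ 2) n k)"
    by (simp only: mult_ac)
  have rhs: "(1 - q) * (qint q (2 * k + 1) * x + gamma_weight q n k * y)
      = ((1 - q) * qint q (2 * k + 1)) * x + ((1 - q) * gamma_weight q n k) * y" for x y
    by (simp only: distrib_left mult.assoc)
  show ?thesis
  proof (cases m)
    case 0
    then have "u = 1" "n = 2 * k"
      by (simp_all add: u_def n)
    then have "gamma_weight q n k = 0"
      by (simp add: gamma_weight_eq_0)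
    then show ?thesis
      unfolding lhs rhs unfolding top low basis basis_shift basis_Suc
      by (simp add: 0 \<open>u = 1\<close> qpoch_Suc algebra_simps power2_eq_square)
  next
    case (Suc l)
    \<comment> \<open>All four products share the factors \<open>1 + taq\<^bsup>2i\<^esup>\<close> with \<open>0 < i < m\<close>.\<close>
    define P where "P = qpoch (- t * a * q ^ 2) (q ^ 2) l"
    have u: "(q ^ 2) ^ Suc l = u"
      by (simp only: u_def Suc power_mult)
    have u': "t * a * q ^ 2 * (q ^ 2) ^ l = t * a * u"
      by (simp only: u[symmetric] power_Suc mult.assoc)
    have A: "qpoch (- t * a) (q ^ 2) m = (1 + t * a) * P"
      by (simp add: Suc qpoch_Suc_shift P_def)
    have B: "qpoch (- t * a * q ^ 2) (q ^ 2) m = P * (1 + t * a * u)"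
      using u' by (simp add: Suc qpoch_Suc P_def)
    have C: "qpoch (- t * a) (q ^ 2) (Suc m) = (1 + t * a) * (P * (1 + t * a * u))"
      by (subst qpoch_Suc_shift) (simp add: B[symmetric])
    have D: "gamma_basis q t (Suc n) (Suc k) = t * t ^ k * P"
    proof -
      have "Suc n - 2 * Suc k = l"
        using Suc by (simp add: n)
      then show ?thesis
        by (simp add: gamma_basis_def P_def a_def algebra_simps power2_eq_square)
    qed
    show ?thesis
      unfolding lhs rhs unfolding top low w basis basis_shift basis_Suc A B C D
      by (simp add: algebra_simps power2_eq_square)
  qed
qed

section \<open>The \<open>\<gamma>\<close>-coefficients\<close>

text \<open>
  The coefficients \<open>b\<^bsub>n,k\<^esub>(q)\<close>, by their recurrence, started at \<open>n = 0\<close> and with natural numbers \<open>k\<close>.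
  For \<open>k = 0\<close> only the first summand remains, with the factor \<open>[1]\<^sub>q = 1\<close>.
\<close>
fun gamma_coeff :: "nat \<Rightarrow> nat \<Rightarrow> int poly" where
  "gamma_coeff 0 k = (if k = 0 then 1 else 0)"
| "gamma_coeff (Suc n) 0 = gamma_coeff n 0"
| "gamma_coeff (Suc n) (Suc k) = qint qvar (2 * Suc k + 1) * gamma_coeff n (Suc k)
     + gamma_weight qvar n k * gamma_coeff n k"

lemma gamma_coeff_eq_0: "n < 2 * k \<Longrightarrow> gamma_coeff n k = 0"
proof (induction n k rule: gamma_coeff.induct)
  case (3 n k)
  then show ?case
    by (simp add: gamma_weight_eq_0)
qed auto

lemma sum_in_Nats: "(\<And>x. x \<in> A \<Longrightarrow> f x \<in> \<nat>) \<Longrightarrow> sum f A \<in> \<nat>"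
  by (induction A rule: infinite_finite_induct) simp_all

lemma coeff_mult_Nats:
  fixes p r :: "'a::comm_semiring_1 poly"
  assumes "\<And>i. coeff p i \<in> \<nat>" "\<And>i. coeff r i \<in> \<nat>"
  shows "coeff (p * r) i \<in> \<nat>"
  unfolding coeff_mult using assms by (intro sum_in_Nats Nats_mult)

lemma coeff_power_Nats:
  fixes p :: "'a::comm_semiring_1 poly"
  assumes "\<And>i. coeff p i \<in> \<nat>"
  shows "coeff (p ^ m) i \<in> \<nat>"
proof (induction m arbitrary: i)
  case (Suc m)
  then show ?case
    unfolding power_Suc using assms by (intro coeff_mult_Nats)
qed (simp add: coeff_1)

lemma coeff_qint_Nats:
  fixes p :: "'a::comm_semiring_1 poly"
  assumes "\<And>i. coeff p i \<in> \<nat>"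
  shows "coeff (qint p m) i \<in> \<nat>"
  unfolding qint_def coeff_sum using assms by (intro sum_in_Nats coeff_power_Nats)

lemma coeff_qvar_Nats: "coeff qvar i \<in> \<nat>"
  by (auto simp: coeff_pCons split: nat.split)

lemma coeff_gamma_coeff_Nats: "coeff (gamma_coeff n k) i \<in> \<nat>"
proof (induction n k arbitrary: i rule: gamma_coeff.induct)
  case (3 n k)
  have one: "coeff (1 + qvar ^ m) i \<in> \<nat>" for m i
    unfolding coeff_add by (intro Nats_add coeff_power_Nats coeff_qvar_Nats) (simp add: coeff_1)
  have "coeff (gamma_weight qvar n k) i \<in> \<nat>" for i
    unfolding gamma_weight_def
    by (intro coeff_mult_Nats one one[of 1, unfolded power_one_right]
        coeff_power_Nats coeff_qint_Nats coeff_qvar_Nats)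
  with 3 show ?case
    unfolding gamma_coeff.simps coeff_add
    by (intro Nats_add coeff_mult_Nats coeff_qint_Nats coeff_qvar_Nats)
qed (simp_all add: coeff_1)

section \<open>The \<open>q\<close>-difference recurrence and the expansion\<close>

lemma eulerian_B_0: "eulerian_B 0 = 1"
proof -
  have "fps_of_poly (qpoch tvar [:qvar ^ 2:] 1) = 1 - fps_X"
    unfolding qpoch_def by (simp only: lessThan_Suc One_nat_def) (simp add: fps_of_poly_diff del: diff_pCons)
  moreover have "Abs_fps (\<lambda>k. 1 :: int poly) * (1 - fps_X) = 1"
    by (rule fps_ext) (simp add: fps_mult_fps_X_commute[symmetric] algebra_simps)
  ultimately have "fps_of_poly (eulerian_B 0) = fps_of_poly 1"
    using eulerian_B_eq[of 0] by (simp only: power_0 add_0 fps_of_poly_1)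
  then show ?thesis
    by (simp only: fps_of_poly_eq_iff)
qed

lemma eulerian_B_Suc:
  "(1 - [:qvar:]) * eulerian_B (Suc n)
    = (1 - tvar * [:qvar:] ^ (2 * n + 2)) * eulerian_B n
      - [:qvar:] * (1 - tvar) * pcompose (eulerian_B n) (tvar * [:qvar:] ^ 2)"
proof -
  define F where "F n = Abs_fps (\<lambda>k. qint qvar (2 * k + 1) ^ n)" for n
  define D where "D n = fps_of_poly (qpoch tvar [:qvar ^ 2:] (n + 1))" for n
  define s where "s = tvar * [:qvar:] ^ 2"
  have s_eq: "s = [:0, qvar ^ 2:]"
    by (simp add: s_def poly_const_pow)
  have fps_s: "fps_of_poly s = fps_const (qvar ^ 2) * fps_X"
    by (simp only: s_eq fps_of_poly_pCons fps_of_poly_0 fps_const_0_eq_0) simp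
  have FD: "F n * D n = fps_of_poly (eulerian_B n)" for n
    unfolding F_def D_def by (rule eulerian_B_eq)
  have comp: "fps_of_poly (pcompose p s) = fps_of_poly p oo (fps_const (qvar ^ 2) * fps_X)" for p
    unfolding fps_s[symmetric] by (rule fps_of_poly_pcompose) (simp add: s_eq)
  have F_Suc: "fps_const (1 - qvar) * F (Suc n)
      = F n - fps_const qvar * (F n oo (fps_const (qvar ^ 2) * fps_X))"
  proof (rule fps_ext)
    fix k
    define Q where "Q = qint qvar (2 * k + 1)"
    have "(1 - qvar) * Q = 1 - qvar * (qvar ^ 2) ^ k"
      unfolding Q_def one_minus_mult_qint by (simp only: power_add power_mult power_one_right mult.commute[of _ qvar])
    then have "(1 - qvar) * Q ^ Suc n = Q ^ n - qvar * ((qvar ^ 2) ^ k * Q ^ n)"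
      by (metis (no_types) left_diff_distrib mult.assoc mult_1_left power_Suc)
    then show "(fps_const (1 - qvar) * F (Suc n)) $ k
        = (F n - fps_const qvar * (F n oo (fps_const (qvar ^ 2) * fps_X))) $ k"
      unfolding fps_compose_linear fps_sub_nth fps_mult_left_const_nth F_def fps_nth_Abs_fps Q_def .
  qed
  have D_Suc: "D (Suc n) = fps_of_poly (1 - tvar * [:qvar:] ^ (2 * n + 2)) * D n"
  proof -
    have "[:qvar ^ 2:] ^ (n + 1) = [:qvar:] ^ (2 * n + 2)"
      by (simp only: poly_const_pow flip: power_mult) (simp add: algebra_simps)
    then show ?thesis
      unfolding D_def by (simp only: add_Suc qpoch_Suc fps_of_poly_mult mult.commute)
  qed
  have D_Suc_shift: "D (Suc n) = fps_of_poly (1 - tvar) * (D n oo (fps_const (qvar ^ 2) * fps_X))"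
  proof -
    have "pcompose (qpoch tvar [:qvar ^ 2:] (n + 1)) s = qpoch (tvar * [:qvar ^ 2:]) [:qvar ^ 2:] (n + 1)"
      unfolding pcompose_qpoch by (simp add: s_eq pcompose_pCons)
    then show ?thesis
      unfolding D_def comp[symmetric] by (simp only: add_Suc qpoch_Suc_shift fps_of_poly_mult)
  qed
  let ?sub = "\<lambda>f. f oo (fps_const (qvar ^ 2) * fps_X)"
  have "fps_of_poly ((1 - [:qvar:]) * eulerian_B (Suc n))
      = fps_const (1 - qvar) * F (Suc n) * D (Suc n)"
    by (simp add: fps_of_poly_mult fps_of_poly_diff fps_of_poly_const mult.assoc flip: FD fps_const_sub)
  also have "\<dots> = F n * D (Suc n) - fps_const qvar * (?sub (F n) * D (Suc n))"
    unfolding F_Suc by (simp only: left_diff_distrib mult.assoc)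
  also have "F n * D (Suc n) = fps_of_poly (1 - tvar * [:qvar:] ^ (2 * n + 2)) * (F n * D n)"
    unfolding D_Suc by (simp only: mult_ac)
  also have "?sub (F n) * D (Suc n) = fps_of_poly (1 - tvar) * (?sub (F n) * ?sub (D n))"
    unfolding D_Suc_shift by (simp only: mult_ac)
  also have "?sub (F n) * ?sub (D n) = ?sub (F n * D n)"
    by (rule fps_compose_mult_distrib[symmetric]) simp
  also have "fps_of_poly (1 - tvar * [:qvar:] ^ (2 * n + 2)) * (F n * D n)
        - fps_const qvar * (fps_of_poly (1 - tvar) * ?sub (F n * D n))
      = fps_of_poly ((1 - tvar * [:qvar:] ^ (2 * n + 2)) * eulerian_B n
        - [:qvar:] * (1 - tvar) * pcompose (eulerian_B n) s)"
    by (simp only: FD comp fps_of_poly_const fps_of_poly_mult fps_of_poly_diff mult.assoc)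
  finally show ?thesis
    unfolding fps_of_poly_eq_iff s_def .
qed

text \<open>
  The expansion, with the summation range extended by vanishing terms so that the same bound
  serves all the sums in the induction step.
\<close>
lemma eulerian_B_eq_gamma_sum:
  "eulerian_B n = (\<Sum>k\<le>n. [:gamma_coeff n k:] * gamma_basis [:qvar:] tvar n k)"
proof (induction n)
  case 0
  then show ?case
    by (simp add: eulerian_B_0 gamma_basis_def one_pCons)
next
  case (Suc n)
  define q :: "int poly poly" where "q = [:qvar:]"
  define c where "c n k = [:gamma_coeff n k:]" for n k
  define w where "w k = gamma_weight q n k" for k
  let ?T = "gamma_basis q tvar (Suc n)"
  have c_0: "c n k = 0" if "n < 2 * k" for k
    using that by (simp add: c_def gamma_coeff_eq_0)
  have c_w: "[:gamma_weight qvar n k:] = w k" for k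
    unfolding w_def q_def by (rule const_poly_gamma_weight)
  have c_Suc_Suc: "c (Suc n) (Suc k) = qint q (2 * Suc k + 1) * c n (Suc k) + w k * c n k" for k
    unfolding c_def gamma_coeff.simps const_poly_add const_poly_mult const_poly_qint c_w q_def ..
  have sub: "pcompose (gamma_basis q tvar n k) (tvar * q ^ 2) = gamma_basis q (tvar * q ^ 2) n k" for k
    by (simp add: gamma_basis_def pcompose_mult pcompose_power pcompose_qpoch pcompose_pCons
        pcompose_uminus q_def poly_const_pow)
  have "(1 - q) * eulerian_B (Suc n)
      = (\<Sum>k\<le>n. c n k * ((1 - tvar * q ^ (2 * n + 2)) * gamma_basis q tvar n k
          - q * (1 - tvar) * gamma_basis q (tvar * q ^ 2) n k))"
  proof -
    have "pcompose (eulerian_B n) (tvar * q ^ 2) = (\<Sum>k\<le>n. c n k * gamma_basis q (tvar * q ^ 2) n k)"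
      unfolding Suc.IH pcompose_sum pcompose_mult sub[symmetric] by (simp add: c_def q_def)
    moreover have "eulerian_B n = (\<Sum>k\<le>n. c n k * gamma_basis q tvar n k)"
      unfolding Suc.IH c_def q_def ..
    ultimately show ?thesis
      unfolding eulerian_B_Suc[of n, folded q_def]
      by (simp only: sum_distrib_left sum_subtractf[symmetric] right_diff_distrib mult.left_commute)
  qed
  also have "\<dots> = (\<Sum>k\<le>n. (1 - q) * (qint q (2 * k + 1) * c n k * ?T k + w k * c n k * ?T (Suc k)))"
  proof (rule sum.cong[OF refl])
    fix k
    show "c n k * ((1 - tvar * q ^ (2 * n + 2)) * gamma_basis q tvar n k
          - q * (1 - tvar) * gamma_basis q (tvar * q ^ 2) n k)
        = (1 - q) * (qint q (2 * k + 1) * c n k * ?T k + w k * c n k * ?T (Suc k))"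
    proof (cases "2 * k \<le> n")
      case True
      show ?thesis
        unfolding gamma_basis_step[OF True] w_def by (simp only: distrib_left mult_ac)
    qed (simp add: c_0)
  qed
  also have "\<dots> = (1 - q) * ((\<Sum>k\<le>n. qint q (2 * k + 1) * c n k * ?T k) + (\<Sum>k\<le>n. w k * c n k * ?T (Suc k)))"
    by (simp only: sum_distrib_left[symmetric] sum.distrib)
  also have "(\<Sum>k\<le>n. qint q (2 * k + 1) * c n k * ?T k)
      = (\<Sum>k\<le>Suc n. qint q (2 * k + 1) * c n k * ?T k)"
    by (simp add: c_0)
  also have "\<dots> = c (Suc n) 0 * ?T 0 + (\<Sum>k\<le>n. qint q (2 * Suc k + 1) * c n (Suc k) * ?T (Suc k))"
    unfolding sum.atMost_Suc_shift by (simp add: c_def qint_def)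
  also have "\<dots> + (\<Sum>k\<le>n. w k * c n k * ?T (Suc k)) = (\<Sum>k\<le>Suc n. c (Suc n) k * ?T k)"
    unfolding sum.atMost_Suc_shift c_Suc_Suc by (simp only: distrib_right sum.distrib add.assoc)
  finally have "(1 - q) * eulerian_B (Suc n) = (1 - q) * (\<Sum>k\<le>Suc n. c (Suc n) k * ?T k)" .
  moreover have "1 - q \<noteq> 0"
    by (simp add: q_def one_pCons)
  ultimately show ?case
    unfolding c_def q_def using mult_left_cancel by blast
qed

theorem theorem5:
  shows "\<exists>b :: nat \<Rightarrow> int \<Rightarrow> int poly.
    (\<forall>n\<ge>1. \<forall>k i. coeff (b n k) i \<in> \<nat>) \<and>
    (\<forall>n\<ge>1. eulerian_B n =
       (\<Sum>k = 0..n div 2. [:b n (int k):] * tvar ^ k *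
          qpoch (- tvar * [:qvar ^ (2 * k + 1):]) [:qvar ^ 2:] (n - 2 * k))) \<and>
    (\<forall>n\<ge>2. \<forall>k::nat. k \<le> n div 2 \<longrightarrow>
       b n (int k) =
         qint qvar (2 * k + 1) * b (n - 1) (int k) +
         (1 + qvar) * (1 + qvar ^ (2 * k - 1)) * qvar ^ (2 * k - 1) *
           qint (qvar ^ 2) (n + 1 - 2 * k) * b (n - 1) (int k - 1)) \<and>
    b 1 0 = 1 \<and>
    (\<forall>n\<ge>1. \<forall>k. k < 0 \<or> k > int (n div 2) \<longrightarrow> b n k = 0)"
proof -
  define b where "b n k = (if k < 0 then 0 else gamma_coeff n (nat k))" for n and k :: int
  have b_int [simp]: "b n (int k) = gamma_coeff n k" for n k
    by (simp add: b_def)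
  have "coeff (b n k) i \<in> \<nat>" for n k i
    by (simp add: b_def coeff_gamma_coeff_Nats)
  moreover have "eulerian_B n = (\<Sum>k = 0..n div 2. [:b n (int k):] * tvar ^ k *
      qpoch (- tvar * [:qvar ^ (2 * k + 1):]) [:qvar ^ 2:] (n - 2 * k))" for n
  proof -
    have "eulerian_B n = (\<Sum>k = 0..n div 2. [:gamma_coeff n k:] * gamma_basis [:qvar:] tvar n k)"
      unfolding eulerian_B_eq_gamma_sum
      by (rule sum.mono_neutral_right) (auto simp: gamma_coeff_eq_0 div_less_iff_less_mult not_le)
    then show ?thesis
      by (simp only: b_int gamma_basis_def poly_const_pow mult.assoc)
  qed
  moreover have "b n (int k) = qint qvar (2 * k + 1) * b (n - 1) (int k) +
      (1 + qvar) * (1 + qvar ^ (2 * k - 1)) * qvar ^ (2 * k - 1) *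
        qint (qvar ^ 2) (n + 1 - 2 * k) * b (n - 1) (int k - 1)" if "n \<ge> 2" for n k
  proof -
    obtain m where n: "n = Suc m"
      using \<open>n \<ge> 2\<close> by (cases n) auto
    show ?thesis
    proof (cases k)
      case 0
      \<comment> \<open>The truncated exponent \<open>2k - 1 = 0\<close> is harmless, since \<open>b\<^bsub>n-1,-1\<^esub> = 0\<close>.\<close>
      then show ?thesis
        by (simp add: n b_def qint_def)
    next
      case (Suc j)
      have j: "int k - 1 = int j" "n + 1 - 2 * k = m - 2 * j" "2 * k - 1 = 2 * j + 1"
        using Suc n by auto
      show ?thesis
        unfolding j b_int unfolding n Suc gamma_coeff.simps gamma_weight_def by simp
    qed
  qed
  moreover have "b 1 0 = 1"
    by (simp add: b_def)
  moreover have "b n k = 0" if "k < 0 \<or> k > int (n div 2)" for n k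
    using that by (auto simp: b_def intro!: gamma_coeff_eq_0)
  ultimately show ?thesis
    by blast
qed

end
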